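(* For all positive integers $k$ and $H$, for all but finitely many positive integers $n$, we have $\mathrm{rk}^{(H)}(k\text{-}\mathsf{thOne}_n)=k$.
   Context: **$k$-th one.** The function $k\text{-}\mathsf{thOne}_n\colon\{0,1\}^n\to\{1,\ldots,n+1\}$ is defined by $$k\text{-}\mathsf{thOne}_n(\sigma_1,\ldots,\sigma_n)=\min\bigl(\{n+1\}\cup\{i\in\{1,\ldots,n\}:\sigma_1+\cdots+\sigma_i=k\}\bigr),$$ i.e. it returns the position of the $k$-th one from the left, or $n+1$ if there are fewer than $k$ ones. **$H$-head rank.** Let $f\colon\Sigma_1\times\cdots\times\Sigma_n\to O$ with all sets finite. An assignment is a pair $(i,\sigma)$ with $i\in\{1,\ldots,n\}$, $\sigma\in\Sigma_i$; $A$ is the set of all assignments. The assignment $(i,\sigma)$ is consistent with $\bar w=(\sigma_1,\ldots,\sigma_n)$ iff $\sigma_i=\sigma$. For a bijection $\tau\colon\{1,\ldots,|A|\}\to A$ (a permutation of $A$), the a-query $q_\tau\colon\Sigma_1\times\cdots\times\Sigma_n\to A$ is defined by $q_\tau(\bar w)=\tau(j)$ for the minimal $j$ such that $\tau(j)$ is consistent with $\bar w$. An $H$-degree a-query is a product $\bar w\mapsto(q_{\tau_1}(\bar w),\ldots,q_{\tau_H}(\bar w))$ of $H$ a-queries. A decision tree over a family of queries is a rooted tree in which each non-leaf node $v$ is labeled by a query $q_v$ from the family and has exactly $|\mathrm{Im}(q_v)|$ outgoing edges, labeled by the distinct elements of $\mathrm{Im}(q_v)$, and each leaf is labeled by an element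 of $O$; on input $\bar w$ one descends from the root, at each $v$ following the edge labeled $q_v(\bar w)$, and outputs the label of the leaf reached. The tree computes $f$ if it outputs $f(\bar w)$ on every input $\bar w$. The depth is the maximal number of edges on a root-to-leaf path. $\mathrm{rk}^{(H)}(f)$ is the minimal depth of a decision tree over $H$-degree a-queries computing $f$. *)

theory Defs
  imports "HOL-Library.FuncSet" "HOL-Library.Extended_Nat"
begin

text \<open>
  An input \<open>w = (\<sigma>\<^sub>1, \<dots>, \<sigma>\<^sub>n)\<close> is an extensional function on \<open>{1..n}\<close>, so that \<open>words n S\<close> is in
  bijection with \<open>S 1 \<times> \<dots> \<times> S n\<close>.
\<close>

definition words :: "nat \<Rightarrow> (nat \<Rightarrow> 's set) \<Rightarrow> (nat \<Rightarrow> 's) set" where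
  "words n S = (\<Pi>\<^sub>E i\<in>{1..n}. S i)"

definition kthOne :: "nat \<Rightarrow> nat \<Rightarrow> (nat \<Rightarrow> nat) \<Rightarrow> nat" where
  "kthOne k n w = Min ({n + 1} \<union> {i \<in> {1..n}. (\<Sum>j=1..i. w j) = k})"


section \<open>Decision trees\<close>

text \<open>
  The edges leaving a node form a partial map from edge labels to subtrees; \<open>decision_tree\<close> requires
  its domain to be the image of the query on the input set \<open>X\<close>.
\<close>

datatype ('x, 'a, 'o) dtree =
    Leaf 'o
  | Node "'x \<Rightarrow> 'a" "'a \<Rightarrow> ('x, 'a, 'o) dtree option"

primrec decision_tree ::
  "('x \<Rightarrow> 'a) set \<Rightarrow> 'x set \<Rightarrow> 'o set \<Rightarrow> ('x, 'a, 'o) dtree \<Rightarrow> bool" where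
  "decision_tree Q X Out (Leaf y) \<longleftrightarrow> y \<in> Out"
| "decision_tree Q X Out (Node q c) \<longleftrightarrow>
     q \<in> Q \<and> dom c = q ` X \<and> (\<forall>b \<in> ran (map_option (decision_tree Q X Out) \<circ> c). b)"

lemma decision_tree_Node:
  "decision_tree Q X Out (Node q c) \<longleftrightarrow>
     q \<in> Q \<and> dom c = q ` X \<and> (\<forall>t \<in> ran c. decision_tree Q X Out t)"
  by (auto simp: ran_def)

primrec run :: "('x, 'a, 'o) dtree \<Rightarrow> 'x \<Rightarrow> 'o" where
  "run (Leaf y) = (\<lambda>w. y)"
| "run (Node q c) = (\<lambda>w. the ((map_option run \<circ> c) (q w)) w)"

lemma run_Node: "c (q w) = Some t \<Longrightarrow> run (Node q c) w = run t w"
  by simp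

text \<open>The maximum is over a finite set whenever every node has finitely many outgoing edges; this
  holds for every tree satisfying \<open>decision_tree Q X Out\<close> with \<open>X\<close> finite.\<close>

primrec depth :: "('x, 'a, 'o) dtree \<Rightarrow> nat" where
  "depth (Leaf y) = 0"
| "depth (Node q c) = Max (insert 0 (Suc ` ran (map_option depth \<circ> c)))"

lemma depth_Node: "depth (Node q c) = Max (insert 0 ((\<lambda>t. Suc (depth t)) ` ran c))"
proof -
  have "Suc ` ran (map_option depth \<circ> c) = (\<lambda>t. Suc (depth t)) ` ran c"
    by (auto simp: ran_def image_def)
  then show ?thesis
    by simp
qed

definition computes :: "('x, 'a, 'o) dtree \<Rightarrow> 'x set \<Rightarrow> ('x \<Rightarrow> 'o) \<Rightarrow> bool" where
  "computes t X f \<longleftrightarrow> (\<forall>w\<in>X. run t w = f w)"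


section \<open>Assignment queries and rank\<close>

definition assignments :: "nat \<Rightarrow> (nat \<Rightarrow> 's set) \<Rightarrow> (nat \<times> 's) set" where
  "assignments n S = (SIGMA i:{1..n}. S i)"

definition consistent :: "nat \<times> 's \<Rightarrow> (nat \<Rightarrow> 's) \<Rightarrow> bool" where
  "consistent a w \<longleftrightarrow> w (fst a) = snd a"

definition assignment_perms :: "nat \<Rightarrow> (nat \<Rightarrow> 's set) \<Rightarrow> (nat \<Rightarrow> nat \<times> 's) set" where
  "assignment_perms n S =
     {\<tau>. bij_betw \<tau> {1..card (assignments n S)} (assignments n S)}"

definition a_query ::
  "nat \<Rightarrow> (nat \<Rightarrow> 's set) \<Rightarrow> (nat \<Rightarrow> nat \<times> 's) \<Rightarrow> (nat \<Rightarrow> 's) \<Rightarrow> nat \<times> 's" where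
  "a_query n S \<tau> w =
     \<tau> (LEAST j. j \<in> {1..card (assignments n S)} \<and> consistent (\<tau> j) w)"

text \<open>The \<open>H\<close>-tuple of answers is a list of length \<open>H\<close>.\<close>

definition a_queries ::
  "nat \<Rightarrow> nat \<Rightarrow> (nat \<Rightarrow> 's set) \<Rightarrow> ((nat \<Rightarrow> 's) \<Rightarrow> (nat \<times> 's) list) set" where
  "a_queries H n S =
     {\<lambda>w. map (\<lambda>\<tau>. a_query n S \<tau> w) \<tau>s | \<tau>s. length \<tau>s = H \<and> set \<tau>s \<subseteq> assignment_perms n S}"

text \<open>The infimum in \<^typ>\<open>enat\<close> is attained if some tree computes \<open>f\<close>, and is \<open>\<infinity>\<close> otherwise.\<close>

definition rk ::
  "nat \<Rightarrow> nat \<Rightarrow> (nat \<Rightarrow> 's set) \<Rightarrow> 'o set \<Rightarrow> ((nat \<Rightarrow> 's) \<Rightarrow> 'o) \<Rightarrow> enat" where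
  "rk H n S Out f =
     Inf {enat (depth t) | t.
       decision_tree (a_queries H n S) (words n S) Out t \<and> computes t (words n S) f}"

end

theory Submission
  imports Defs
begin

text \<open>
  Upper bound: an a-query listing \<open>(p + 1, 1), \<dots>, (n, 1)\<close> first finds the next one after position
  \<open>p\<close>, so \<open>k\<close> queries suffice.

  Lower bound: an adversary keeps a large set \<open>A\<close> of free positions, all zero in a base word, with no
  fixed one between them. Given a query of degree \<open>H\<close>, it drops at most \<open>H\<close> positions, after which
  each of the \<open>H\<close> components only looks for a one in some order of the free positions. It then fixes
  the query's answer by setting to one a single position left of a still large \<open>A' \<subseteq> A\<close> and any
  number of positions right of \<open>A'\<close>. On words that are zero elsewhere outside \<open>A'\<close>, this lowers
  the number of ones sought in \<open>A'\<close> by only one, so a tree of depth below \<open>k\<close> reaches a leaf while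
  the output still varies.
\<close>

section \<open>The combinatorial lemma\<close>

lemma obtain_initial_segment:
  fixes A :: "'a::linorder set"
  assumes "finite A" "m \<le> card A"
  obtains L where "L \<subseteq> A" "card L = m" "\<And>x y. x \<in> L \<Longrightarrow> y \<in> A - L \<Longrightarrow> x < y"
proof -
  have "\<exists>L\<subseteq>A. card L = m \<and> (\<forall>x\<in>L. \<forall>y\<in>A - L. x < y)"
    using assms(2)
  proof (induction m)
    case 0
    then show ?case by (intro exI[of _ "{}"]) auto
  next
    case (Suc m)
    then obtain L where L: "L \<subseteq> A" "card L = m" "\<forall>x\<in>L. \<forall>y\<in>A - L. x < y"
      by auto
    have fin: "finite L" "finite (A - L)"
      using L(1) assms(1) finite_subset by auto
    have "A - L \<noteq> {}"
      using L Suc.prems by auto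
    then obtain x where x: "x \<in> A - L" "\<forall>y\<in>A - L. x \<le> y"
      using fin Min_in Min_le by metis
    then have "x < y" if "y \<in> A - insert x L" for y
      using that by (auto simp: order_less_le)
    with x L fin show ?case
      by (intro exI[of _ "insert x L"]) auto
  qed
  with that show thesis by blast
qed

text \<open>
  If no \<open>j \<in> A\<close> is \<open>p\<close>-below many smaller elements of \<open>A\<close>, then, among sufficiently many of the smallest
  elements of \<open>A\<close>, some \<open>a\<close> is \<open>p\<close>-below any given later \<open>j\<close>, for all \<open>p\<close> at once; one \<open>a\<close> then
  serves many \<open>j\<close> by the pigeonhole principle.
\<close>

lemma dominating_subset:
  "\<exists>N. \<forall>A R. finite A \<and> N \<le> card A \<and> finite R \<and> card R \<le> r \<longrightarrow>
     (\<exists>A' J a. A' \<subseteq> A \<and> M \<le> card A' \<and> J \<subseteq> A \<and> a \<in> J \<and> (\<forall>i\<in>A'. a < i) \<and>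
        (\<forall>j\<in>J. j \<noteq> a \<longrightarrow> (\<forall>i\<in>A'. i < j)) \<and>
        (\<forall>p\<in>R. \<exists>j\<in>J. \<forall>i\<in>A'. (p :: 'a::linorder \<Rightarrow> 'b::linorder) j \<le> p i))"
  (is "\<exists>N. \<forall>A R. finite A \<and> N \<le> card A \<and> finite R \<and> card R \<le> r \<longrightarrow> ?concl A R")
proof (induction r)
  case 0
  \<comment> \<open>With no rank functions to serve, the minimum of \<open>A\<close> is taken as
    \<open>a\<close> and the rest of \<open>A\<close> as \<open>A'\<close>.\<close>
  have "?concl A {}" if A: "finite A" "Suc M \<le> card A" for A :: "'a set"
  proof (intro exI conjI)
    have "A \<noteq> {}" using A by auto
    then show "{Min A} \<subseteq> A" "M \<le> card (A - {Min A})"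
      using A by auto
    show "\<forall>i\<in>A - {Min A}. Min A < i"
      using A Min_le[of A] by (auto simp: order_less_le)
  qed auto
  then show ?case
    by (intro exI[of _ "Suc M"]) auto
next
  case (Suc r)
  then obtain N where N0: "\<forall>A R. finite A \<and> N \<le> card A \<and> finite R \<and> card R \<le> r \<longrightarrow> ?concl A R" ..
  have N: "?concl A R" if "finite A" "N \<le> card A" "finite R" "card R \<le> r" for A R
    by (rule N0[THEN spec, THEN spec, THEN mp]) (simp add: that)
  \<comment> \<open>\<open>m\<close> exceeds \<open>Suc r * N\<close>, so one set of size at most
    \<open>N\<close> per rank function cannot cover \<open>m\<close> elements; removing
    \<open>m\<close> from \<open>Suc (m + m * M)\<close> elements leaves more than
    \<open>m * M\<close> for the final pigeonhole.\<close>
  define m where "m = Suc (Suc r * N)"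
  have "?concl A R"
    if A: "finite A" "Suc (m + m * M) \<le> card A" and R: "finite R" "card R \<le> Suc r" for A R
  proof (cases "card R \<le> r")
    case True
    have "N \<le> card A" using A(2) by (simp add: m_def)
    then show ?thesis using A(1) R(1) True by (intro N)
  next
    case cR: False
    \<comment> \<open>If some \<open>inv p j\<close> is large, \<open>j\<close> alone serves
      \<open>p\<close>: the induction hypothesis is applied inside \<open>inv p j\<close>, all of
      which lies left of \<open>j\<close>, to the other rank functions.\<close>
    define inv where "inv p j = {i \<in> A. i < j \<and> p j \<le> p i}" for p :: "'a \<Rightarrow> 'b" and j
    show ?thesis
    proof (cases "\<exists>p\<in>R. \<exists>j\<in>A. N \<le> card (inv p j)")
      case True
      then obtain p j where pj: "p \<in> R" "j \<in> A" "N \<le> card (inv p j)" by blast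
      have "card (R - {p}) \<le> r" "finite (R - {p})"
        using R pj(1) by auto
      moreover have "finite (inv p j)"
        using A(1) by (simp add: inv_def)
      ultimately have "?concl (inv p j) (R - {p})"
        using pj(3) by (intro N)
      then obtain A' J a where *: "A' \<subseteq> inv p j" "M \<le> card A'" "J \<subseteq> inv p j" "a \<in> J"
        "\<forall>i\<in>A'. a < i" "\<forall>j\<in>J. j \<noteq> a \<longrightarrow> (\<forall>i\<in>A'. i < j)"
        "\<forall>p\<in>R - {p}. \<exists>j\<in>J. \<forall>i\<in>A'. p j \<le> p i"
        by blast
      show ?thesis
      proof (rule exI[of _ A'], rule exI[of _ "insert j J"], rule exI[of _ a], intro conjI)
        show "\<forall>q\<in>R. \<exists>j'\<in>insert j J. \<forall>i\<in>A'. q j' \<le> q i"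
        proof
          fix q assume "q \<in> R"
          then show "\<exists>j'\<in>insert j J. \<forall>i\<in>A'. q j' \<le> q i"
            using *(1,7) by (cases "q = p") (auto simp: inv_def)
        qed
      qed (use * pj(2) in \<open>auto simp: inv_def\<close>)
    next
      case False
      then have small: "card (inv p j) \<le> N" if "p \<in> R" "j \<in> A" for p j
        using that by force
      obtain L where L: "L \<subseteq> A" "card L = m" "\<And>x y. x \<in> L \<Longrightarrow> y \<in> A - L \<Longrightarrow> x < y"
        using obtain_initial_segment[OF A(1), of m] A(2) by auto
      have finL: "finite L" using L(1) A(1) finite_subset by auto
      have "\<exists>a\<in>L. \<forall>p\<in>R. p a \<le> p j" if j: "j \<in> A - L" for j
      proof (rule ccontr)
        assume none: "\<not> ?thesis"
        \<comment> \<open>If no \<open>a\<close> works for \<open>j\<close>, every element of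
          \<open>L\<close> has rank at least that of \<open>j\<close> under some \<open>p\<close>;
          being left of \<open>j\<close>, it lies in \<open>inv p j\<close>. These sets are too
          small to cover \<open>L\<close>.\<close>
        have "L \<subseteq> (\<Union>p\<in>R. inv p j)"
        proof
          fix a assume "a \<in> L"
          then obtain p where "p \<in> R" "p j \<le> p a"
            using none by (meson nle_le)
          then show "a \<in> (\<Union>p\<in>R. inv p j)"
            using L \<open>a \<in> L\<close> j by (auto simp: inv_def)
        qed
        then have "card L \<le> card (\<Union>p\<in>R. inv p j)"
          using A(1) R(1) by (intro card_mono) (auto simp: inv_def)
        also have "\<dots> \<le> (\<Sum>p\<in>R. card (inv p j))"
          using R(1) by (rule card_UN_le)
        also have "\<dots> \<le> (\<Sum>p\<in>R. N)"
          using small j by (intro sum_mono) auto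
        also have "\<dots> \<le> Suc r * N"
          using R(2) by (simp only: sum_constant of_nat_id mult_le_mono1)
        finally show False using L(2) by (simp add: m_def)
      qed
      then have cover: "A - L \<subseteq> (\<Union>a\<in>L. {j \<in> A - L. \<forall>p\<in>R. p a \<le> p j})"
        by blast
      \<comment> \<open>Pigeonhole: more than \<open>m * M\<close> elements \<open>j\<close>, each
        assigned to one of the \<open>m\<close> elements of \<open>L\<close>.\<close>
      have "\<exists>a\<in>L. M \<le> card {j \<in> A - L. \<forall>p\<in>R. p a \<le> p j}"
      proof (rule ccontr)
        assume none: "\<not> ?thesis"
        have "card (A - L) \<le> card (\<Union>a\<in>L. {j \<in> A - L. \<forall>p\<in>R. p a \<le> p j})"
          using A(1) finL cover by (intro card_mono) auto
        also have "\<dots> \<le> (\<Sum>a\<in>L. card {j \<in> A - L. \<forall>p\<in>R. p a \<le> p j})"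
          using finL by (rule card_UN_le)
        also have "\<dots> \<le> (\<Sum>a\<in>L. M)"
          using none by (intro sum_mono) (meson nle_le)
        also have "\<dots> = m * M" using L(2) by simp
        finally show False
          using A L(1,2) finL by (simp add: card_Diff_subset)
      qed
      then obtain a where a: "a \<in> L" "M \<le> card {j \<in> A - L. \<forall>p\<in>R. p a \<le> p j}"
        by blast
      show ?thesis
        by (rule exI[of _ "{j \<in> A - L. \<forall>p\<in>R. p a \<le> p j}"], rule exI[of _ "{a}"], rule exI[of _ a])
          (use a L in auto)
    qed
  qed
  then show ?case by blast
qed


section \<open>The lower bound\<close>

lemma finite_words: "(\<And>i. finite (S i)) \<Longrightarrow> finite (words n S)"
  by (simp add: words_def finite_PiE)

text \<open>The lower bound fixes \<open>Out\<close> before its threshold, whereas the output set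
  \<open>{1..n + 1}\<close> grows with \<open>n\<close>; passing to \<open>UNIV\<close> makes the
  threshold uniform in \<open>n\<close>.\<close>

lemma decision_tree_mono:
  assumes "decision_tree Q X Out t" "Out \<subseteq> Out'"
  shows "decision_tree Q X Out' t"
  using assms(1)
proof (induction t)
  case (Leaf y)
  then show ?case using assms(2) by auto
next
  case (Node q c)
  have "decision_tree Q X Out' t" if t: "t \<in> ran c" for t
  proof -
    obtain b where "c b = Some t" using t by (auto simp: ran_def)
    then have "Some t \<in> range c" by (metis rangeI)
    moreover have "decision_tree Q X Out t"
      using Node.prems t unfolding decision_tree_Node by blast
    ultimately show ?thesis
      using Node.IH by auto
  qed
  then show ?case
    using Node.prems unfolding decision_tree_Node by blast
qed

lemma depth_child:
  assumes "decision_tree Q X Out (Node q c)" "finite X" "c b = Some t"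
  shows "depth t < depth (Node q c)"
proof -
  have "finite (ran c)"
    using assms by (auto intro!: finite_ran simp: decision_tree_Node)
  moreover have "t \<in> ran c"
    using assms(3) by (auto simp: ran_def)
  ultimately have "Suc (depth t) \<le> depth (Node q c)"
    unfolding depth_Node by (intro Max_ge) auto
  then show ?thesis by simp
qed

lemma assignment_position:
  assumes "\<tau> \<in> assignment_perms n S" "a \<in> assignments n S"
  obtains j where "j \<in> {1..card (assignments n S)}" "\<tau> j = a"
proof -
  have "a \<in> \<tau> ` {1..card (assignments n S)}"
    using assms by (simp add: assignment_perms_def bij_betw_def)
  with that show thesis by blast
qed

text \<open>Both minima are at most \<open>b\<close>, and below \<open>b\<close> the predicates
  agree. This is how a query is shown not to distinguish two words.\<close>

lemma Least_eqI_upto: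
  fixes b :: "'a::wellorder"
  assumes "P b" "Q b" "\<And>l. l < b \<Longrightarrow> P l \<longleftrightarrow> Q l"
  shows "(LEAST l. P l) = (LEAST l. Q l)"
proof (rule antisym)
  have "(LEAST l. Q l) \<le> b" "(LEAST l. P l) \<le> b"
    using assms by (auto intro: Least_le)
  then show "(LEAST l. P l) \<le> (LEAST l. Q l)" "(LEAST l. Q l) \<le> (LEAST l. P l)"
    using assms by (metis LeastI Least_le order_le_less)+
qed

text \<open>
  Here \<open>B\<close> is the set of free positions of the base word \<open>w0\<close>; a one at a position \<open>j\<close> of
  lowest \<open>p\<close>-rank makes the query blind to the positions in \<open>A'\<close>.
\<close>

definition determined_by_ones ::
  "nat \<Rightarrow> (nat \<Rightarrow> nat \<times> nat) \<Rightarrow> (nat \<Rightarrow> nat) \<Rightarrow> nat \<Rightarrow> (nat \<Rightarrow> nat) \<Rightarrow> bool" where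
  "determined_by_ones n \<tau> w0 e p \<longleftrightarrow>
     (\<forall>B A' j w w'. B \<subseteq> {1..n} - {e} \<and> (\<forall>i\<in>B. w0 i = 0) \<and> A' \<subseteq> B \<and>
        j \<in> B - A' \<and> (\<forall>i\<in>A'. p j \<le> p i) \<and> (\<forall>i. i \<notin> B \<longrightarrow> w i = w0 i) \<and>
        (\<forall>i. i \<notin> A' \<longrightarrow> w i = w' i) \<and> w j = 1 \<longrightarrow>
        a_query n (\<lambda>_. {0, 1}) \<tau> w = a_query n (\<lambda>_. {0, 1}) \<tau> w')"

text \<open>
  With \<open>e\<close> the index of the answer on \<open>w0\<close>, that answer stays consistent after changes in \<open>B\<close>,
  and it precedes every \<open>(i, 0)\<close> with \<open>i \<in> B\<close>; so only the assignments \<open>(i, 1)\<close> with \<open>i \<in> B\<close> can change the answer.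
  The rank \<open>p i\<close> is the position of \<open>(i, 1)\<close>, capped at the position of the answer on \<open>w0\<close>.
\<close>

lemma ex_determined_by_ones:
  assumes \<tau>: "\<tau> \<in> assignment_perms n (\<lambda>_. {0, 1})" and w0: "w0 \<in> words n (\<lambda>_. {0, 1})" and n: "n \<ge> 1"
  shows "\<exists>e p. determined_by_ones n \<tau> w0 e p"
proof -
  define D where "D = {1..card (assignments n (\<lambda>_. {0, 1::nat}))}"
  define ok where "ok w j \<longleftrightarrow> j \<in> D \<and> consistent (\<tau> j) w" for w j
  have query: "a_query n (\<lambda>_. {0, 1}) \<tau> w = \<tau> (LEAST j. ok w j)" for w
    by (simp add: a_query_def ok_def D_def)
  have "(1, w0 1) \<in> assignments n (\<lambda>_. {0, 1})"
    using w0 n by (auto simp: assignments_def words_def)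
  then obtain j0 where "j0 \<in> D" "\<tau> j0 = (1, w0 1)"
    using assignment_position[OF \<tau>] unfolding D_def by blast
  then have "ok w0 j0"
    by (simp add: ok_def consistent_def)
  define m where "m = (LEAST j. ok w0 j)"
  have m: "ok w0 m" "\<And>j. ok w0 j \<Longrightarrow> m \<le> j"
    unfolding m_def using LeastI[of "ok w0", OF \<open>ok w0 j0\<close>] Least_le[of "ok w0"] by auto
  define pos where "pos i = (SOME j. j \<in> D \<and> \<tau> j = (i, 1))" for i
  have pos: "pos i \<in> D \<and> \<tau> (pos i) = (i, 1)" if "i \<in> {1..n}" for i
  proof -
    have "(i, 1) \<in> assignments n (\<lambda>_. {0, 1::nat})"
      using that by (auto simp: assignments_def)
    then have "\<exists>j. j \<in> D \<and> \<tau> j = (i, 1)"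
      using assignment_position[OF \<tau>] unfolding D_def by blast
    then show ?thesis
      unfolding pos_def by (rule someI_ex)
  qed
  have inj: "inj_on \<tau> D"
    using \<tau> by (auto simp: assignment_perms_def bij_betw_def D_def)
  define p where "p i = min m (pos i)" for i
  have const: "a_query n (\<lambda>_. {0, 1}) \<tau> w = a_query n (\<lambda>_. {0, 1}) \<tau> w'"
    if B: "B \<subseteq> {1..n} - {fst (\<tau> m)}" "\<forall>i\<in>B. w0 i = 0" and A': "A' \<subseteq> B"
      and j: "j \<in> B - A'" "\<forall>i\<in>A'. p j \<le> p i"
      and w: "\<forall>i. i \<notin> B \<longrightarrow> w i = w0 i" "\<forall>i. i \<notin> A' \<longrightarrow> w i = w' i" "w j = 1"
    for B A' j w w'
    unfolding query
  proof (rule arg_cong[of _ _ \<tau>], rule Least_eqI_upto)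
    have j': "j \<in> {1..n}" "j \<in> B" "w' j = 1"
      using j B w by auto
    \<comment> \<open>The answer on \<open>w0\<close> survives all changes inside \<open>B\<close>,
      and both words have a one at \<open>j\<close>; so whichever of \<open>m\<close> and
      \<open>pos j\<close> is smaller is a consistent position for both.\<close>
    have "fst (\<tau> m) \<notin> B" using B by auto
    then have "ok w m" "ok w' m"
      using m(1) w(1,2) A' by (auto simp: ok_def consistent_def)
    moreover have "ok w (pos j)" "ok w' (pos j)"
      using pos[of j] j' w by (auto simp: ok_def consistent_def)
    ultimately show "ok w (p j)" "ok w' (p j)"
      unfolding p_def min_def by auto
    fix l assume l: "l < p j"
    show "ok w l \<longleftrightarrow> ok w' l"
    proof (cases "l \<in> D \<and> fst (\<tau> l) \<in> A'")
      case False
      then show ?thesis using w(2) by (auto simp: ok_def consistent_def)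
    next
      case True
      define i where "i = fst (\<tau> l)"
      have i: "i \<in> A'" "i \<in> B" "i \<in> {1..n}"
        using True A' B by (auto simp: i_def)
      have "\<tau> l \<in> assignments n (\<lambda>_. {0, 1})"
        using \<tau> True by (auto simp: assignment_perms_def bij_betw_def D_def)
      then consider "\<tau> l = (i, 0)" | "\<tau> l = (i, 1)"
        by (auto simp: assignments_def i_def)
      then have False
      proof cases
        \<comment> \<open>\<open>(i, 0)\<close> is consistent with \<open>w0\<close>, hence cannot
          come before \<open>m\<close>.\<close>
        case 1
        then have "ok w0 l"
          using True B(2) i by (auto simp: ok_def consistent_def)
        then show False
          using m(2) l by (fastforce simp: p_def)
      next
        \<comment> \<open>Now \<open>l = pos i\<close>, and \<open>p j \<le> p i \<le> pos i\<close>
          contradicts \<open>l < p j\<close>.\<close>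
        case 2
        then have "l = pos i"
          using inj pos[OF i(3)] True by (auto simp: inj_on_def)
        moreover have "p j \<le> p i" using j(2) i by blast
        ultimately show False using l by (auto simp: p_def min_def split: if_splits)
      qed
      then show ?thesis ..
    qed
  qed
  show ?thesis
    unfolding determined_by_ones_def
    by (intro exI[of _ "fst (\<tau> m)"] exI[of _ p] allI impI, elim conjE, rule const, assumption+)
qed

text \<open>Prefix sums before \<open>a\<close> stay below \<open>K\<close>, so the added one is the
  \<open>K\<close>-th; without it the prefix sum at \<open>a\<close> is wrong, so \<open>a\<close>
  is not the output. This ends the adversary argument when a single one is still sought.\<close>

lemma kthOne_separates:
  assumes "a \<in> {1..n}" "w a = 0" "(\<Sum>j=1..a. w j) + 1 = K"
  shows "kthOne K n (w(a := 1)) \<noteq> kthOne K n w"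
proof -
  let ?T = "\<lambda>w. {n + 1} \<union> {i \<in> {1..n}. (\<Sum>j=1..i. w j) = K}"
  have "(\<Sum>j=1..a. (w(a := 1)) j) = (\<Sum>j=1..a. w j + (if j = a then 1 else 0))"
    using assms(2) by (intro sum.cong) auto
  also have "\<dots> = K"
    using assms by (simp add: sum.distrib)
  finally have sum1: "(\<Sum>j=1..a. (w(a := 1)) j) = K" .
  have "Min (?T (w(a := 1))) = a"
  proof (rule Min_eqI)
    show "finite (?T (w(a := 1)))" by simp
    show "a \<in> ?T (w(a := 1))" using assms(1) sum1 by blast
  next
    fix i assume i: "i \<in> ?T (w(a := 1))"
    show "a \<le> i"
    proof (rule ccontr)
      assume "\<not> a \<le> i"
      then have "i < a" by simp
      have "(\<Sum>j=1..i. (w(a := 1)) j) = (\<Sum>j=1..i. w j)"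
        using \<open>i < a\<close> by (intro sum.cong) auto
      also have "\<dots> \<le> (\<Sum>j=1..a. w j)"
        using \<open>i < a\<close> by (intro sum_mono2) auto
      finally show False
        using i assms \<open>i < a\<close> by auto
    qed
  qed
  moreover have "Min (?T w) \<in> ?T w"
    by (intro Min_in) auto
  ultimately show ?thesis
    unfolding kthOne_def using assms by auto
qed

text \<open>
  The prefix-sum invariant says that the ones of \<open>w0\<close> lie left or right of all of \<open>A\<close>, with
  \<open>K - k\<close> of them on the left.
\<close>

lemma shallow_tree_fails:
  "\<exists>N. \<forall>n A w0 t. A \<subseteq> {1..n} \<and> N \<le> card A \<and> w0 \<in> words n (\<lambda>_. {0, 1}) \<and> (\<forall>i\<in>A. w0 i = 0) \<and>
     (\<forall>i\<in>A. (\<Sum>j=1..i. w0 j) + k = K) \<and>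
     decision_tree (a_queries H n (\<lambda>_. {0, 1})) (words n (\<lambda>_. {0, 1})) Out t \<and> depth t < k \<longrightarrow>
     (\<exists>w\<in>words n (\<lambda>_. {0, 1}). \<exists>w'\<in>words n (\<lambda>_. {0, 1}).
        (\<forall>i. i \<notin> A \<longrightarrow> w i = w0 i) \<and> (\<forall>i. i \<notin> A \<longrightarrow> w' i = w0 i) \<and>
        run t w = run t w' \<and> kthOne K n w \<noteq> kthOne K n w')"
proof (induction k)
  case 0
  then show ?case by simp
next
  case (Suc k)
  let ?W = "\<lambda>n. words n (\<lambda>_. {0, 1::nat})"
  let ?goal = "\<lambda>n A w0 t. \<exists>w\<in>?W n. \<exists>w'\<in>?W n.
        (\<forall>i. i \<notin> A \<longrightarrow> w i = w0 i) \<and> (\<forall>i. i \<notin> A \<longrightarrow> w' i = w0 i) \<and>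
        run t w = run t w' \<and> kthOne K n w \<noteq> kthOne K n w'"
  from Suc obtain N where N0: "\<forall>n A w0 t. A \<subseteq> {1..n} \<and> N \<le> card A \<and> w0 \<in> ?W n \<and> (\<forall>i\<in>A. w0 i = 0) \<and>
     (\<forall>i\<in>A. (\<Sum>j=1..i. w0 j) + k = K) \<and>
     decision_tree (a_queries H n (\<lambda>_. {0, 1})) (?W n) Out t \<and> depth t < k \<longrightarrow> ?goal n A w0 t" ..
  have N: "?goal n A w0 t" if "A \<subseteq> {1..n}" "N \<le> card A" "w0 \<in> ?W n" "\<forall>i\<in>A. w0 i = 0"
    "\<forall>i\<in>A. (\<Sum>j=1..i. w0 j) + k = K"
    "decision_tree (a_queries H n (\<lambda>_. {0, 1})) (?W n) Out t" "depth t < k" for n A w0 t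
    by (rule N0[THEN spec, THEN spec, THEN spec, THEN spec, THEN mp]) (intro conjI that)
  obtain N' where "\<forall>A R. finite A \<and> N' \<le> card A \<and> finite R \<and> card R \<le> H \<longrightarrow>
     (\<exists>A' J a. A' \<subseteq> A \<and> N \<le> card A' \<and> J \<subseteq> A \<and> a \<in> J \<and> (\<forall>i\<in>A'. a < i) \<and>
        (\<forall>j\<in>J. j \<noteq> a \<longrightarrow> (\<forall>i\<in>A'. i < j)) \<and>
        (\<forall>p\<in>R. \<exists>j\<in>J. \<forall>i\<in>A'. (p :: nat \<Rightarrow> nat) j \<le> p i))"
    using dominating_subset ..
  note N' = this[rule_format]
  have main: "?goal n A w0 t"
    if A: "A \<subseteq> {1..n}" "Suc (N' + H) \<le> card A" and w0: "w0 \<in> ?W n" "\<forall>i\<in>A. w0 i = 0"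
      "\<forall>i\<in>A. (\<Sum>j=1..i. w0 j) + Suc k = K"
      and t: "decision_tree (a_queries H n (\<lambda>_. {0, 1})) (?W n) Out t" "depth t < Suc k" for n A w0 t
  proof -
    have finA: "finite A" using A(1) finite_subset by auto
    have "A \<noteq> {}" using A(2) by auto
    then have n: "n \<ge> 1" using A(1) by auto
    have upd: "(\<lambda>i. if i \<in> J then 1 else w0 i) \<in> ?W n" if "J \<subseteq> A" for J
      using that A(1) w0(1) by (auto simp: words_def PiE_iff extensional_def)
    \<comment> \<open>The adversary's move, shared by leaves and nodes: once ones are fixed on
      \<open>J\<close> and \<open>t\<close> behaves like \<open>t'\<close>, the induction hypothesis
      applies to \<open>A'\<close> and \<open>t'\<close>.\<close>
    have step: "?goal n A w0 t"
      if J: "J \<subseteq> A" "A' \<subseteq> A" "a \<in> J" "\<forall>i\<in>A'. a < i" "\<forall>j\<in>J. j \<noteq> a \<longrightarrow> (\<forall>i\<in>A'. i < j)"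
        and cA': "N \<le> card A'"
        and t': "decision_tree (a_queries H n (\<lambda>_. {0, 1})) (?W n) Out t'" "depth t' < k"
        and eq: "\<And>w. w \<in> ?W n \<Longrightarrow> \<forall>i. i \<notin> A' \<longrightarrow> w i = (if i \<in> J then 1 else w0 i) \<Longrightarrow> run t w = run t' w"
      for J A' a t'
    proof -
      define w1 where "w1 = (\<lambda>i. if i \<in> J then 1 else w0 i)"
      have w1: "w1 \<in> ?W n" using upd J by (simp add: w1_def)
      have "\<forall>i\<in>A'. w1 i = 0"
        using J w0(2) by (auto simp: w1_def)
      moreover have "(\<Sum>j=1..i. w1 j) + k = K" if i: "i \<in> A'" for i
      proof -
        \<comment> \<open>Every element of \<open>J\<close> other than \<open>a\<close> lies right
          of \<open>A'\<close>, so only \<open>a\<close> contributes.\<close>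
        have "(\<Sum>j=1..i. w1 j) = (\<Sum>j=1..i. w0 j + (if j = a then 1 else 0))"
          using i J w0(2) by (intro sum.cong) (fastforce simp: w1_def)+
        also have "\<dots> = (\<Sum>j=1..i. w0 j) + 1"
          using i J A(1) by (auto simp: sum.distrib)
        finally show ?thesis using w0(3) i J(2) by auto
      qed
      ultimately have "?goal n A' w1 t'"
        using N[of A' n w1 t'] J A(1) w1 cA' t' by blast
      then obtain w w' where w: "w \<in> ?W n" "w' \<in> ?W n" "\<forall>i. i \<notin> A' \<longrightarrow> w i = w1 i"
        "\<forall>i. i \<notin> A' \<longrightarrow> w' i = w1 i" "run t' w = run t' w'" "kthOne K n w \<noteq> kthOne K n w'"
        by blast
      have "run t w = run t w'"
        using w eq[of w] eq[of w'] by (simp add: w1_def)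
      moreover have "\<forall>i. i \<notin> A \<longrightarrow> w i = w0 i" "\<forall>i. i \<notin> A \<longrightarrow> w' i = w0 i"
        using w J by (metis subsetD w1_def)+
      ultimately show ?thesis using w by blast
    qed
    show ?thesis
    proof (cases t)
      case (Leaf y)
      show ?thesis
      proof (cases k)
        case 0
        obtain a where a: "a \<in> A" using \<open>A \<noteq> {}\<close> by blast
        have "w0(a := 1) \<in> ?W n"
          using a A(1) w0(1) by (auto simp: words_def PiE_iff extensional_def)
        moreover have "kthOne K n (w0(a := 1)) \<noteq> kthOne K n w0"
          using a A(1) w0 0 by (intro kthOne_separates) auto
        ultimately show ?thesis
          using w0(1) a Leaf by (intro bexI[of _ "w0(a := 1)"] bexI[of _ w0]) auto
      next
        case (Suc k')
        \<comment> \<open>A leaf asks nothing, so a move with no rank functions is made and the same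
          leaf is kept; its depth \<open>0\<close> is still below \<open>k\<close>.\<close>
        obtain A' J a where "A' \<subseteq> A" "N \<le> card A'" "J \<subseteq> A" "a \<in> J" "\<forall>i\<in>A'. a < i"
          "\<forall>j\<in>J. j \<noteq> a \<longrightarrow> (\<forall>i\<in>A'. i < j)"
          using N'[of A "{}"] A(2) finA by auto
        then show ?thesis
          using t Leaf Suc by (intro step[of J A' a t]) auto
      qed
    next
      case (Node q c)
      obtain \<tau>s where \<tau>s: "length \<tau>s = H" "set \<tau>s \<subseteq> assignment_perms n (\<lambda>_. {0, 1})"
        and q: "q = (\<lambda>w. map (\<lambda>\<tau>. a_query n (\<lambda>_. {0, 1}) \<tau> w) \<tau>s)"
        using t(1) unfolding Node decision_tree_Node a_queries_def by blast
      have "\<forall>\<tau>\<in>set \<tau>s. \<exists>e p. determined_by_ones n \<tau> w0 e p"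
        using ex_determined_by_ones[OF _ w0(1) n] \<tau>s(2) by blast
      then obtain e p where ep: "\<And>\<tau>. \<tau> \<in> set \<tau>s \<Longrightarrow> determined_by_ones n \<tau> w0 (e \<tau>) (p \<tau>)"
        by metis
      \<comment> \<open>The at most \<open>H\<close> indices of the answers on \<open>w0\<close>
        must keep their values, so they are no longer free.\<close>
      define B where "B = A - e ` set \<tau>s"
      have card_le: "card (f ` set \<tau>s) \<le> H" for f :: "_ \<Rightarrow> 'z"
        by (metis \<tau>s(1) card_image_le card_length finite_set le_trans)
      have "card A - card (e ` set \<tau>s) \<le> card B"
        unfolding B_def by (rule diff_card_le_card_Diff) simp
      then have "N' \<le> card B" using A(2) card_le[of e] by linarith
      then obtain A' J a where J: "A' \<subseteq> B" "N \<le> card A'" "J \<subseteq> B" "a \<in> J" "\<forall>i\<in>A'. a < i"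
        "\<forall>j\<in>J. j \<noteq> a \<longrightarrow> (\<forall>i\<in>A'. i < j)" "\<forall>p\<in>p ` set \<tau>s. \<exists>j\<in>J. \<forall>i\<in>A'. p j \<le> p i"
        using N'[of B "p ` set \<tau>s"] finA card_le[of p] by (auto simp: B_def)
      define w1 where "w1 = (\<lambda>i. if i \<in> J then 1 else w0 i)"
      have BA: "B \<subseteq> A" by (auto simp: B_def)
      have w1: "w1 \<in> ?W n" using upd J(3) BA by (auto simp: w1_def)
      have disj: "i \<notin> A'" if "i \<in> J" for i
        using J(5,6) that by (metis less_irrefl)
      \<comment> \<open>For each component, \<open>J\<close> contains a \<open>j\<close> whose one
        hides \<open>A'\<close>. All words agreeing with \<open>w1\<close> outside \<open>A'\<close>
        thus follow the same edge.\<close>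
      have q_const: "q w1 = q w" if w: "w \<in> ?W n" "\<forall>i. i \<notin> A' \<longrightarrow> w i = w1 i" for w
        unfolding q
      proof (rule map_cong[OF refl])
        fix \<tau> assume \<tau>: "\<tau> \<in> set \<tau>s"
        then obtain j where j: "j \<in> J" "\<forall>i\<in>A'. p \<tau> j \<le> p \<tau> i" using J(7) by blast
        show "a_query n (\<lambda>_. {0, 1}) \<tau> w1 = a_query n (\<lambda>_. {0, 1}) \<tau> w"
        proof (rule ep[OF \<tau>, unfolded determined_by_ones_def, rule_format, of B A' j], intro conjI)
          show "B \<subseteq> {1..n} - {e \<tau>}" "\<forall>i\<in>B. w0 i = 0"
            using A(1) w0(2) \<tau> by (auto simp: B_def)
          show "j \<in> B - A'" "w1 j = 1" "\<forall>i. i \<notin> B \<longrightarrow> w1 i = w0 i"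
            using j J(3) disj by (auto simp: w1_def)
        qed (use w j J(1) in auto)
      qed
      have "q w1 \<in> dom c" using t(1) w1 by (simp add: Node decision_tree_Node)
      then obtain t' where t': "c (q w1) = Some t'" by blast
      then have "t' \<in> ran c" by (auto simp: ran_def)
      show ?thesis
      proof (rule step[of J A' a t'])
        show "decision_tree (a_queries H n (\<lambda>_. {0, 1})) (?W n) Out t'"
          using t(1) \<open>t' \<in> ran c\<close> by (simp only: Node decision_tree_Node)
        have "depth t' < depth t"
          unfolding Node using depth_child[OF t(1)[unfolded Node] finite_words t'] by simp
        then show "depth t' < k" using t(2) by simp
        fix w assume "w \<in> ?W n" "\<forall>i. i \<notin> A' \<longrightarrow> w i = (if i \<in> J then 1 else w0 i)"
        then have "q w = q w1" using q_const[of w] by (simp add: w1_def)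
        then show "run t w = run t' w"
          unfolding Node using t' by (intro run_Node) simp
      qed (use J BA in auto)
    qed
  qed
  show ?case
  \<comment> \<open>\<open>H\<close> pays for the dropped indices; \<open>Suc\<close> keeps
    \<open>A\<close> nonempty.\<close>
  proof (intro exI[of _ "Suc (N' + H)"] allI impI, elim conjE)
    fix n A w0 t
    assume "A \<subseteq> {1..n}" "Suc (N' + H) \<le> card A" "w0 \<in> ?W n" "\<forall>i\<in>A. w0 i = 0"
      "\<forall>i\<in>A. (\<Sum>j=1..i. w0 j) + Suc k = K"
      "decision_tree (a_queries H n (\<lambda>_. {0, 1})) (?W n) Out t" "depth t < Suc k"
    then show "?goal n A w0 t" by (rule main)
  qed
qed


section \<open>The upper bound\<close>

definition next_one :: "nat \<Rightarrow> nat \<Rightarrow> (nat \<Rightarrow> nat) \<Rightarrow> nat" where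
  "next_one n p w = (LEAST i. i = n + 1 \<or> i \<in> {p<..n} \<and> w i = 1)"

text \<open>Only ones strictly after \<open>p\<close> are counted, but \<open>i\<close> may equal
  \<open>p\<close>: for \<open>k = 0\<close> and \<open>p \<le> n + 1\<close> the value is then
  \<open>p\<close>, the position already found.\<close>

definition kthOne_from :: "nat \<Rightarrow> nat \<Rightarrow> nat \<Rightarrow> (nat \<Rightarrow> nat) \<Rightarrow> nat" where
  "kthOne_from k n p w = Min ({n + 1} \<union> {i \<in> {p..n}. (\<Sum>j=Suc p..i. w j) = k})"

text \<open>The permutation starts with \<open>(p + 1, 1), ..., (n, 1)\<close>, so the first
  consistent entry there is the next one. Any other answer means that no one follows
  \<open>p\<close>, and \<open>d\<close> decodes it as \<open>n + 1\<close>.\<close>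

lemma next_one_query:
  assumes "p \<le> n" and n: "n \<ge> 1"
  obtains \<tau> d where "\<tau> \<in> assignment_perms n (\<lambda>_. {0, 1})"
    "\<And>w. w \<in> words n (\<lambda>_. {0, 1}) \<Longrightarrow> d (a_query n (\<lambda>_. {0, 1}) \<tau> w) = next_one n p w"
proof -
  define L :: "(nat \<times> nat) list" where
    "L = map (\<lambda>i. (i, 1)) ([Suc p..<Suc n] @ [1..<Suc p]) @ map (\<lambda>i. (i, 0)) [1..<Suc n]"
  \<comment> \<open>Permutations are indexed from 1, list entries from 0.\<close>
  define \<tau> where "\<tau> j = L ! (j - 1)" for j
  have "set ([Suc p..<Suc n] @ [1..<Suc p]) = {1..n}" "set [1..<Suc n] = {1..n}"
    using assms by auto
  then have "set L = (\<lambda>i. (i, 1)) ` {1..n} \<union> (\<lambda>i. (i, 0)) ` {1..n}"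
    unfolding L_def set_append set_map by metis
  then have "set L = assignments n (\<lambda>_. {0, 1})"
    by (auto simp: assignments_def image_iff)
  moreover have "distinct L"
  proof -
    have map: "distinct (map (\<lambda>i. (i, b)) xs)" if "distinct xs" for b :: nat and xs :: "nat list"
      using that by (simp add: distinct_map inj_on_def)
    have app: "distinct ([Suc p..<Suc n] @ [1..<Suc p])"
      unfolding distinct_append by (intro conjI distinct_upt) auto
    have disj: "set (map (\<lambda>i. (i, 1 :: nat)) xs) \<inter> set (map (\<lambda>i. (i, 0)) ys) = {}" for xs ys :: "nat list"
      by auto
    show ?thesis
      unfolding L_def
      by (rule distinct_append[THEN iffD2], intro conjI map app disj distinct_upt)
  qed
  ultimately have L: "distinct L" "set L = assignments n (\<lambda>_. {0, 1})"
    by simp_all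
  have len: "length L = card (assignments n (\<lambda>_. {0, 1::nat}))"
    using L distinct_card by metis
  have "bij_betw (\<lambda>j. j - 1) {1..length L} {..<length L}"
    by (rule bij_betw_byWitness[of _ Suc]) auto
  then have "bij_betw ((!) L \<circ> (\<lambda>j. j - 1)) {1..length L} (set L)"
    using bij_betw_nth[OF L(1) refl refl] by (rule bij_betw_trans)
  then have bij: "bij_betw \<tau> {1..length L} (set L)"
    by (simp add: \<tau>_def[abs_def] comp_def)
  then have perm: "\<tau> \<in> assignment_perms n (\<lambda>_. {0, 1})"
    by (simp add: assignment_perms_def L len)
  have \<tau>_low: "\<tau> j = (p + j, 1)" if "j \<in> {1..n - p}" for j
  proof -
    have "1 \<le> j" "j - 1 < n - p" "j - 1 < n" using that by auto
    then show ?thesis by (simp add: \<tau>_def L_def nth_append del: upt_Suc)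
  qed
  have low: "j \<in> {1..length L}" if "j \<in> {1..n - p}" for j
    using that by (simp add: L_def del: upt_Suc)
  define d where "d a = (if snd a = 1 \<and> p < fst a then fst a else n + 1)" for a :: "nat \<times> nat"
  have "d (a_query n (\<lambda>_. {0, 1}) \<tau> w) = next_one n p w" if w: "w \<in> words n (\<lambda>_. {0, 1})" for w
  proof -
    define ok where "ok j \<longleftrightarrow> j \<in> {1..length L} \<and> consistent (\<tau> j) w" for j
    define m where "m = (LEAST j. ok j)"
    have query: "a_query n (\<lambda>_. {0, 1}) \<tau> w = \<tau> m"
      by (simp add: a_query_def m_def ok_def len)
    have ok_low: "ok j \<longleftrightarrow> w (p + j) = 1" if "j \<in> {1..n - p}" for j
      using that low[OF that] \<tau>_low[OF that] by (auto simp: ok_def consistent_def)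
    show ?thesis
    proof (cases "\<exists>i\<in>{p<..n}. w i = 1")
      case True
      then obtain i where i: "i \<in> {p<..n}" "w i = 1" by blast
      then have oki: "ok (i - p)" by (intro ok_low[THEN iffD2]) auto
      then have m: "ok m" "m \<le> i - p"
        unfolding m_def by (auto intro: LeastI Least_le)
      then have m': "m \<in> {1..n - p}" using i by (auto simp: ok_def)
      have "next_one n p w = p + m"
        unfolding next_one_def
      proof (rule Least_equality)
        show "p + m = n + 1 \<or> p + m \<in> {p<..n} \<and> w (p + m) = 1"
          using m m' ok_low by auto
        fix l assume l: "l = n + 1 \<or> l \<in> {p<..n} \<and> w l = 1"
        show "p + m \<le> l"
        proof (cases "l = n + 1")
          case False
          then have "ok (l - p)" using l by (intro ok_low[THEN iffD2]) auto
          then have "m \<le> l - p" unfolding m_def by (rule Least_le)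
          then show ?thesis using l False by auto
        qed (use m' in auto)
      qed
      then show ?thesis
        unfolding query using \<tau>_low[OF m'] m' by (simp add: d_def)
    next
      case False
      have "next_one n p w = n + 1"
        unfolding next_one_def using False by (intro Least_equality) auto
      moreover have "d (\<tau> m) = n + 1"
      proof -
        have "(1, w 1) \<in> assignments n (\<lambda>_. {0, 1})"
          using w n by (auto simp: assignments_def words_def)
        then obtain j where "j \<in> {1..length L}" "\<tau> j = (1, w 1)"
          using assignment_position[OF perm] unfolding len by blast
        then have "ok j" by (simp add: ok_def consistent_def)
        then have "ok m" unfolding m_def by (rule LeastI)
        then have "\<tau> m \<in> assignments n (\<lambda>_. {0, 1})" "w (fst (\<tau> m)) = snd (\<tau> m)"
          using bij L by (auto simp: ok_def consistent_def bij_betw_def)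
        then show ?thesis
          using False by (auto simp: d_def assignments_def)
      qed
      ultimately show ?thesis unfolding query by simp
    qed
  qed
  with perm that show thesis by blast
qed

text \<open>With \<open>r\<close> the next one, sums starting after \<open>p\<close> vanish before
  \<open>r\<close>, and from \<open>r\<close> on exceed those starting after \<open>r\<close> by
  exactly one.\<close>

lemma kthOne_from_next_one:
  assumes "p \<le> n" and w: "w \<in> words n (\<lambda>_. {0, 1})"
  shows "kthOne_from (Suc k) n p w = kthOne_from k n (next_one n p w) w"
proof -
  define r where "r = next_one n p w"
  let ?P = "\<lambda>i. i = n + 1 \<or> i \<in> {p<..n} \<and> w i = 1"
  have r: "?P r"
    unfolding r_def next_one_def by (rule LeastI[of ?P "n + 1"]) simp
  have least: "r \<le> i" if "?P i" for i
    unfolding r_def next_one_def using that by (rule Least_le)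
  have zero: "w j = 0" if "p < j" "j < r" for j
  proof -
    have "r \<le> n + 1" using least by blast
    then have "w j \<in> {0, 1}" using that w by (auto simp: words_def)
    moreover have "w j \<noteq> 1" using least[of j] that \<open>r \<le> n + 1\<close> by auto
    ultimately show ?thesis by auto
  qed
  have "p < r" using r assms(1) by auto
  have before: "(\<Sum>j=Suc p..i. w j) = 0" if "i < r" for i
    using that zero by (intro sum.neutral) auto
  have after: "(\<Sum>j=Suc p..i. w j) = Suc (\<Sum>j=Suc r..i. w j)" if "r \<le> i" "i \<le> n" for i
  proof -
    have "(\<Sum>j=Suc p..i. w j) = (\<Sum>j\<in>{Suc p..<r} \<union> ({r} \<union> {Suc r..i}). w j)"
      using that \<open>p < r\<close> by (intro sum.cong) auto
    also have "\<dots> = (\<Sum>j\<in>{Suc p..<r}. w j) + (w r + (\<Sum>j=Suc r..i. w j))"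
      by (subst sum.union_disjoint) auto
    also have "(\<Sum>j\<in>{Suc p..<r}. w j) = 0"
      using zero by (intro sum.neutral) auto
    also have "w r = 1" using r that by auto
    finally show ?thesis by simp
  qed
  have "{i \<in> {p..n}. (\<Sum>j=Suc p..i. w j) = Suc k} = {i \<in> {r..n}. (\<Sum>j=Suc r..i. w j) = k}"
  proof (rule Collect_cong)
    show "i \<in> {p..n} \<and> (\<Sum>j=Suc p..i. w j) = Suc k \<longleftrightarrow> i \<in> {r..n} \<and> (\<Sum>j=Suc r..i. w j) = k" for i
      using \<open>p < r\<close> by (cases "i < r") (auto simp: before after simp del: sum_eq_0_iff)
  qed
  then show ?thesis by (simp add: kthOne_from_def r_def)
qed

text \<open>Each query finds one further one, and the subtree restarts from it. The case
  \<open>p = 0\<close>, \<open>k = 0\<close> is excluded because its value \<open>0\<close> is not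
  an allowed output.\<close>

lemma kthOne_tree:
  assumes "H \<ge> 1" "n \<ge> 1" "p \<le> n + 1" "p \<ge> 1 \<or> k \<ge> 1"
  shows "\<exists>t. decision_tree (a_queries H n (\<lambda>_. {0, 1})) (words n (\<lambda>_. {0, 1})) {1..n + 1} t \<and>
    depth t \<le> k \<and> computes t (words n (\<lambda>_. {0, 1})) (kthOne_from k n p)"
  using assms(3,4)
proof (induction k arbitrary: p)
  case 0
  have "kthOne_from 0 n p w = p" for w
    unfolding kthOne_from_def using 0 by (intro Min_eqI) auto
  then show ?case
    using 0 by (intro exI[of _ "Leaf p"]) (auto simp: computes_def)
next
  case (Suc k)
  let ?S = "\<lambda>_::nat. {0, 1::nat}"
  show ?case
  proof (cases "p = n + 1")
    case True
    then have "kthOne_from (Suc k) n p w = n + 1" for w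
      by (simp add: kthOne_from_def)
    then show ?thesis
      by (intro exI[of _ "Leaf (n + 1)"]) (auto simp: computes_def)
  next
    case False
    then have p: "p \<le> n" using Suc.prems by simp
    then obtain \<tau> d where \<tau>: "\<tau> \<in> assignment_perms n ?S"
      and d: "\<And>w. w \<in> words n ?S \<Longrightarrow> d (a_query n ?S \<tau> w) = next_one n p w"
      using next_one_query[OF p assms(2)] by blast
    have "\<forall>r\<in>{1..n + 1}. \<exists>t. decision_tree (a_queries H n ?S) (words n ?S) {1..n + 1} t \<and>
        depth t \<le> k \<and> computes t (words n ?S) (kthOne_from k n r)"
      using Suc.IH by auto
    then obtain T where T: "\<And>r. r \<in> {1..n + 1} \<Longrightarrow>
        decision_tree (a_queries H n ?S) (words n ?S) {1..n + 1} (T r)"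
        "\<And>r. r \<in> {1..n + 1} \<Longrightarrow> depth (T r) \<le> k"
        "\<And>r. r \<in> {1..n + 1} \<Longrightarrow> computes (T r) (words n ?S) (kthOne_from k n r)"
      by metis
    have range: "next_one n p w \<in> {1..n + 1}" for w
    proof -
      let ?P = "\<lambda>i. i = n + 1 \<or> i \<in> {p<..n} \<and> w i = 1"
      have "?P (next_one n p w)"
        unfolding next_one_def by (rule LeastI[of ?P "n + 1"]) simp
      then show ?thesis by auto
    qed
    \<comment> \<open>One a-query is enough, so it is repeated \<open>H\<close> times;
      \<open>H \<ge> 1\<close> lets \<open>hd\<close> recover its answer.\<close>
    define q where "q = (\<lambda>w. map (\<lambda>\<tau>. a_query n ?S \<tau> w) (replicate H \<tau>))"
    define c where "c = (\<lambda>l. if l \<in> q ` words n ?S then Some (T (d (hd l))) else None)"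
    have c: "c (q w) = Some (T (next_one n p w))" if "w \<in> words n ?S" for w
    proof -
      have "hd (q w) = a_query n ?S \<tau> w"
        using assms(1) by (cases H) (auto simp: q_def)
      then show ?thesis using that d by (simp add: c_def)
    qed
    have "q \<in> a_queries H n ?S"
      unfolding a_queries_def q_def using \<tau> by (auto intro!: exI[of _ "replicate H \<tau>"])
    moreover have dom: "dom c = q ` words n ?S"
      by (auto simp: c_def dom_def)
    moreover have ran: "\<exists>r\<in>{1..n + 1}. t = T r" if t: "t \<in> ran c" for t
    proof -
      obtain l where "c l = Some t" using t by (auto simp: ran_def)
      moreover from this obtain w where "w \<in> words n ?S" "l = q w"
        using dom by auto
      ultimately show ?thesis using c range by auto
    qed
    ultimately have "decision_tree (a_queries H n ?S) (words n ?S) {1..n + 1} (Node q c)"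
      unfolding decision_tree_Node using T(1) by blast
    moreover have "depth (Node q c) \<le> Suc k"
    proof -
      have "finite (ran c)"
        using dom by (auto intro!: finite_ran finite_words)
      then show ?thesis
        unfolding depth_Node by (subst Max_le_iff) (auto dest: ran intro: T(2) simp del: atLeastAtMost_iff)
    qed
    moreover have "computes (Node q c) (words n ?S) (kthOne_from (Suc k) n p)"
      unfolding computes_def
    proof
      fix w assume w: "w \<in> words n ?S"
      then have "run (Node q c) w = run (T (next_one n p w)) w"
        using c by (intro run_Node) auto
      also have "\<dots> = kthOne_from k n (next_one n p w) w"
        using T(3)[OF range] w unfolding computes_def by blast
      finally show "run (Node q c) w = kthOne_from (Suc k) n p w"
        using kthOne_from_next_one[OF p w] by simp
    qed
    ultimately show ?thesis by blast
  qed
qed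

lemma kthOne_from_0:
  assumes "k \<ge> 1"
  shows "kthOne_from k n 0 = kthOne k n"
proof
  fix w
  have "{i \<in> {0..n}. (\<Sum>j=Suc 0..i. w j) = k} = {i \<in> {1..n}. (\<Sum>j=1..i. w j) = k}"
    using assms by (auto simp: Suc_le_eq intro!: gr0I)
  then show "kthOne_from k n 0 w = kthOne k n w"
    by (simp only: kthOne_from_def kthOne_def)
qed

section \<open>Combination of the two bounds\<close>

theorem theorem3:
  fixes k H :: nat
  assumes "k \<ge> 1" and "H \<ge> 1"
  shows "finite {n::nat. n \<ge> 1 \<and> rk H n (\<lambda>_. {0, 1}) {1..n + 1} (kthOne k n) \<noteq> enat k}"
proof -
  let ?S = "\<lambda>_::nat. {0, 1::nat}"
  let ?fails = "\<lambda>n A w0 t. \<exists>w\<in>words n ?S. \<exists>w'\<in>words n ?S.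
        (\<forall>i. i \<notin> A \<longrightarrow> w i = w0 i) \<and> (\<forall>i. i \<notin> A \<longrightarrow> w' i = w0 i) \<and>
        run t w = run t w' \<and> kthOne k n w \<noteq> kthOne k n w'"
  obtain N where N0: "\<forall>n A w0 t. A \<subseteq> {1..n} \<and> N \<le> card A \<and> w0 \<in> words n ?S \<and> (\<forall>i\<in>A. w0 i = 0) \<and>
     (\<forall>i\<in>A. (\<Sum>j=1..i. w0 j) + k = k) \<and>
     decision_tree (a_queries H n ?S) (words n ?S) (UNIV :: nat set) t \<and> depth t < k \<longrightarrow> ?fails n A w0 t"
    using shallow_tree_fails ..
  have N: "?fails n A w0 t" if "A \<subseteq> {1..n}" "N \<le> card A" "w0 \<in> words n ?S" "\<forall>i\<in>A. w0 i = 0"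
    "\<forall>i\<in>A. (\<Sum>j=1..i. w0 j) + k = k"
    "decision_tree (a_queries H n ?S) (words n ?S) (UNIV :: nat set) t" "depth t < k" for n A w0 t
    by (rule N0[THEN spec, THEN spec, THEN spec, THEN spec, THEN mp]) (intro conjI that)
  have "rk H n ?S {1..n + 1} (kthOne k n) = enat k" if n: "N \<le> n" "n \<ge> 1" for n
    unfolding rk_def
  proof (rule antisym)
    obtain t where "decision_tree (a_queries H n ?S) (words n ?S) {1..n + 1} t" "depth t \<le> k"
      "computes t (words n ?S) (kthOne k n)"
      using kthOne_tree[of H n 0 k, unfolded kthOne_from_0[OF assms(1)]] assms n(2) by auto
    then show "Inf {enat (depth t) |t. decision_tree (a_queries H n ?S) (words n ?S) {1..n + 1} t \<and>
        computes t (words n ?S) (kthOne k n)} \<le> enat k"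
      by (intro Inf_lower2[of "enat (depth t)"]) auto
  next
    \<comment> \<open>The adversary starts from the all-zero word with every position free;
      \<open>undefined\<close> outside \<open>{1..n}\<close> makes it extensional.\<close>
    define w0 :: "nat \<Rightarrow> nat" where "w0 = (\<lambda>i. if i \<in> {1..n} then 0 else undefined)"
    have w0: "w0 \<in> words n ?S" by (auto simp: w0_def words_def)
    have sum0: "\<forall>i\<in>{1..n}. (\<Sum>j=1..i. w0 j) + k = k"
      by (auto simp: w0_def)
    have "k \<le> depth t" if t: "decision_tree (a_queries H n ?S) (words n ?S) {1..n + 1} t"
        "computes t (words n ?S) (kthOne k n)" for t
    proof (rule ccontr)
      assume "\<not> k \<le> depth t"
      then have "?fails n {1..n} w0 t"
        using n w0 sum0 decision_tree_mono[OF t(1) subset_UNIV]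
        by (intro N[of "{1..n}" n w0 t]) (auto simp: w0_def)
      then show False using t(2) by (metis computes_def)
    qed
    then show "enat k \<le> Inf {enat (depth t) |t. decision_tree (a_queries H n ?S) (words n ?S) {1..n + 1} t \<and>
        computes t (words n ?S) (kthOne k n)}"
      by (intro Inf_greatest) auto
  qed
  then have "{n. n \<ge> 1 \<and> rk H n ?S {1..n + 1} (kthOne k n) \<noteq> enat k} \<subseteq> {..<N}"
    by (auto intro: ccontr)
  then show ?thesis
    by (rule finite_subset) simp
qed

end
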